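(* Let $X$ be a sieve-complete space, $Y$ a $\mu$-space, and let $F\colon\mathcal{K}(X)\to\mathcal{K}(Y)$ be a monotone set tri-quotient map. Then $Y$ is sieve-complete and $l(Y)\leq l(X)$.
   Context: All spaces are completely regular. $\mathcal{K}(X)$ is the set of all compact subsets of $X$; $\mathcal{T}(X)$ is the topology of $X$. For $\mathcal{S}(X)\subset 2^X$, a map $F\colon\mathcal{S}(X)\to 2^Y$ is monotone if $K\subset L$ implies $F(K)\subset F(L)$. It is set tri-quotient if there is a map $s\colon\mathcal{T}(X)\to\mathcal{T}(Y)$ such that: (str1) $s(U)\subset\bigcup\{F(K):K\in\mathcal{S}(X),\ K\subset U\}$; (str2) $s(X)=Y$; (str3) $U\subset V$ implies $s(U)\subset s(V)$; (str4) if $y\in s(U)$ and $\mathcal{W}$ is a cover of $\bigcup\{K\in F^{-1}(y):K\subset U\}$ by open subsets of $X$, then $y\in s(\bigcup\mathcal{E})$ for some finite $\mathcal{E}\subset\mathcal{W}$; here $F^{-1}(y)=\{K\in\mathcal{S}(X):y\in F(K)\}$. A space is a $\mu$-space if every closed bounded subset is compact, where $A\subset X$ is bounded if every continuous real-valued function on $X$ is bounded on $A$. A sieve on $X$ is a sequence of open covers $\{U_\alpha:\alpha\in A_n\}_{n\in\mathbb{N}}$ of $X$ with maps $\pi_n\colon A_{n+1}\to A_n$ such that $U_\alpha=\bigcup\{U_\beta:\beta\in\pi_n^{-1}(\alpha)\}$ for all $n$ and $\alpha\in A_n$; a $\pi$-chain is a sequence $(\alpha_n)$ with $\alpha_n\in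 A_n$ and $\pi_n(\alpha_{n+1})=\alpha_n$. The sieve is complete if for every $\pi$-chain $(\alpha_n)$, every filter base on $X$ which meshes with $\{U_{\alpha_n}\}$ (every member meets every $U_{\alpha_n}$) has a cluster point in $X$. A space with a complete sieve is sieve-complete. $l(X)$ denotes the Lindelöf number of $X$. *)

theory Defs
  imports "HOL-Analysis.Analysis"
begin

text \<open>Standing convention: spaces are completely regular (Tychonoff: completely regular and T1).\<close>
definition tychonoff :: "'a topology \<Rightarrow> bool" where
  "tychonoff X \<longleftrightarrow> completely_regular_space X \<and> t1_space X"

definition boundedin_space :: "'a topology \<Rightarrow> 'a set \<Rightarrow> bool" where
  "boundedin_space X A \<longleftrightarrow> A \<subseteq> topspace X \<and>
     (\<forall>f. continuous_map X euclideanreal f \<longrightarrow> bounded (f ` A))"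

definition mu_space :: "'a topology \<Rightarrow> bool" where
  "mu_space X \<longleftrightarrow> (\<forall>A. closedin X A \<and> boundedin_space X A \<longrightarrow> compactin X A)"

definition is_sieve :: "'a topology \<Rightarrow> (nat \<Rightarrow> 'i set) \<Rightarrow> (nat \<Rightarrow> 'i \<Rightarrow> 'a set)
    \<Rightarrow> (nat \<Rightarrow> 'i \<Rightarrow> 'i) \<Rightarrow> bool" where
  "is_sieve X I U p \<longleftrightarrow>
     (\<forall>n. \<forall>\<alpha>\<in>I n. openin X (U n \<alpha>)) \<and>
     (\<forall>n. \<Union>(U n ` I n) = topspace X) \<and>
     (\<forall>n. \<forall>\<beta>\<in>I (Suc n). p n \<beta> \<in> I n) \<and>
     (\<forall>n. \<forall>\<alpha>\<in>I n. U n \<alpha> = \<Union>{U (Suc n) \<beta> | \<beta>. \<beta> \<in> I (Suc n) \<and> p n \<beta> = \<alpha>})"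

definition pi_chain :: "(nat \<Rightarrow> 'i set) \<Rightarrow> (nat \<Rightarrow> 'i \<Rightarrow> 'i) \<Rightarrow> (nat \<Rightarrow> 'i) \<Rightarrow> bool" where
  "pi_chain I p c \<longleftrightarrow> (\<forall>n. c n \<in> I n) \<and> (\<forall>n. p n (c (Suc n)) = c n)"

definition filter_base_on :: "'a topology \<Rightarrow> 'a set set \<Rightarrow> bool" where
  "filter_base_on X \<B> \<longleftrightarrow> \<B> \<noteq> {} \<and> (\<forall>B\<in>\<B>. B \<noteq> {} \<and> B \<subseteq> topspace X) \<and>
     (\<forall>B1\<in>\<B>. \<forall>B2\<in>\<B>. \<exists>B3\<in>\<B>. B3 \<subseteq> B1 \<inter> B2)"

definition complete_sieve :: "'a topology \<Rightarrow> (nat \<Rightarrow> 'i set) \<Rightarrow> (nat \<Rightarrow> 'i \<Rightarrow> 'a set)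
    \<Rightarrow> (nat \<Rightarrow> 'i \<Rightarrow> 'i) \<Rightarrow> bool" where
  "complete_sieve X I U p \<longleftrightarrow> is_sieve X I U p \<and>
     (\<forall>c \<B>. pi_chain I p c \<and> filter_base_on X \<B> \<and>
        (\<forall>B\<in>\<B>. \<forall>n. B \<inter> U n (c n) \<noteq> {}) \<longrightarrow>
        (\<exists>x\<in>topspace X. \<forall>B\<in>\<B>. x \<in> X closure_of B))"

definition sieve_complete_with :: "'a topology \<Rightarrow> 'i itself \<Rightarrow> bool" where
  "sieve_complete_with X _ \<longleftrightarrow>
     (\<exists>(I :: nat \<Rightarrow> 'i set) U p. complete_sieve X I U p)"

text \<open>\<open>lindelof_le X K\<close>: every open cover of X has a subcover of cardinality at most |K|;
  for infinite K this says l(X) \<le> |K|.\<close>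
definition lindelof_le :: "'a topology \<Rightarrow> 'c set \<Rightarrow> bool" where
  "lindelof_le X K \<longleftrightarrow> (\<forall>\<U>. (\<forall>U\<in>\<U>. openin X U) \<and> topspace X \<subseteq> \<Union>\<U> \<longrightarrow>
      (\<exists>\<V>\<subseteq>\<U>. topspace X \<subseteq> \<Union>\<V> \<and> \<V> \<lesssim> K))"

definition monotone_on_compacts :: "'a topology \<Rightarrow> ('a set \<Rightarrow> 'b set) \<Rightarrow> bool" where
  "monotone_on_compacts X F \<longleftrightarrow>
     (\<forall>K L. compactin X K \<and> compactin X L \<and> K \<subseteq> L \<longrightarrow> F K \<subseteq> F L)"

definition maps_compacts :: "'a topology \<Rightarrow> 'b topology \<Rightarrow> ('a set \<Rightarrow> 'b set) \<Rightarrow> bool" where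
  "maps_compacts X Y F \<longleftrightarrow> (\<forall>K. compactin X K \<longrightarrow> compactin Y (F K))"

text \<open>Set tri-quotient map \<open>F : \<K>(X) \<rightarrow> 2^Y\<close>; \<open>s\<close> is only relevant on open sets.\<close>
definition set_tri_quotient :: "'a topology \<Rightarrow> 'b topology \<Rightarrow> ('a set \<Rightarrow> 'b set) \<Rightarrow> bool" where
  "set_tri_quotient X Y F \<longleftrightarrow> (\<exists>s :: 'a set \<Rightarrow> 'b set.
     (\<forall>U. openin X U \<longrightarrow> openin Y (s U)) \<and>
     (\<forall>U. openin X U \<longrightarrow> s U \<subseteq> \<Union>{F K | K. compactin X K \<and> K \<subseteq> U}) \<and>
     s (topspace X) = topspace Y \<and>
     (\<forall>U V. openin X U \<and> openin X V \<and> U \<subseteq> V \<longrightarrow> s U \<subseteq> s V) \<and>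
     (\<forall>U y \<W>. openin X U \<and> y \<in> s U \<and> (\<forall>W\<in>\<W>. openin X W) \<and>
        \<Union>{K. compactin X K \<and> y \<in> F K \<and> K \<subseteq> U} \<subseteq> \<Union>\<W> \<longrightarrow>
        (\<exists>\<E>. finite \<E> \<and> \<E> \<subseteq> \<W> \<and> y \<in> s (\<Union>\<E>))))"

end

theory Submission
  imports Defs "HOL-Algebra.Free_Abelian_Groups"
begin

no_notation Congruence.eq_closure_of (\<open>closure'_of\<index>\<close>)

text \<open>
  Call a family of sets complete if every filter base meshing with it has a cluster point. By
  Koenig's lemma, the unions \<open>W\<^sub>n\<close> of finite subsets \<open>E\<^sub>n\<close> of the levels of a complete sieve form a
  complete family when the parents of \<open>E\<^sub>n\<^sub>+\<^sub>1\<close> lie in \<open>E\<^sub>n\<close>. The adherence of \<open>(W\<^sub>n)\<close>, that is, the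
  intersection of the closures, is compact and has the \<open>W\<^sub>n\<close> as a neighbourhood base, so compact
  sets \<open>K\<^sub>n \<subseteq> W\<^sub>n\<close> together with the adherence form a compact set \<open>L\<close>. Hence every selection
  \<open>y\<^sub>n \<in> s(W\<^sub>n)\<close> lies in the compact set \<open>F(L)\<close>. In a \<open>\<mu>\<close>-space this makes the adherence of the
  sequence \<open>s(W\<^sub>n)\<close> bounded, hence compact, and the sequence itself complete. So the sets \<open>s(W)\<close>,
  indexed by the histories \<open>E\<^sub>0, \<dots>, E\<^sub>n\<close>, form a complete sieve on \<open>Y\<close>.

  A sieve-complete regular space has Lindelof number at most \<open>\<kappa>\<close> if and only if it has a complete
  sieve with at most \<open>\<kappa>\<close> members on each level, and the passage from \<open>X\<close> to \<open>Y\<close> preserves this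
  bound because an infinite set has no more finite subsets than elements.
\<close>

section \<open>Filter bases and compactness\<close>

definition adherence :: "'a topology \<Rightarrow> 'a set set \<Rightarrow> 'a set" where
  "adherence X \<B> = (\<Inter>B\<in>\<B>. X closure_of B)"

definition meshes :: "'a set set \<Rightarrow> 'a set set \<Rightarrow> bool" where
  "meshes \<B> \<W> \<longleftrightarrow> (\<forall>B\<in>\<B>. \<forall>W\<in>\<W>. B \<inter> W \<noteq> {})"

lemma adherence_nonempty_iff:
  assumes "filter_base_on X \<B>"
  shows "adherence X \<B> \<noteq> {} \<longleftrightarrow> (\<exists>x\<in>topspace X. \<forall>B\<in>\<B>. x \<in> X closure_of B)"
proof -
  have "x \<in> topspace X" if "B \<in> \<B>" "\<forall>B\<in>\<B>. x \<in> X closure_of B" for x B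
    using that closure_of_subset_topspace[of X B] by blast
  then show ?thesis
    using assms by (auto simp: adherence_def filter_base_on_def)
qed

lemma adherence_antimono:
  assumes "\<forall>W\<in>\<W>. \<exists>B\<in>\<B>. B \<subseteq> W"
  shows "adherence X \<B> \<subseteq> adherence X \<W>"
  unfolding adherence_def
proof (rule INT_greatest)
  fix W assume "W \<in> \<W>"
  then obtain B where "B \<in> \<B>" "B \<subseteq> W" using assms by blast
  then show "(\<Inter>B\<in>\<B>. X closure_of B) \<subseteq> X closure_of W"
    by (meson INT_lower closure_of_mono order_trans)
qed

lemma closedin_adherence: "\<W> \<noteq> {} \<Longrightarrow> closedin X (adherence X \<W>)"
  unfolding adherence_def by (intro closedin_Inter) auto

lemma adherence_empty_if_disjoint_open:
  assumes "openin X G" "adherence X \<W> \<subseteq> G" "\<forall>W\<in>\<W>. \<exists>B\<in>\<B>. B \<subseteq> W"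
    and "B \<in> \<B>" "B \<inter> G = {}"
  shows "adherence X \<B> = {}"
proof -
  have "adherence X \<B> \<subseteq> G \<inter> X closure_of B"
    using adherence_antimono[OF assms(3), of X] assms(2,4) by (auto simp: adherence_def)
  then show ?thesis
    using openin_Int_closure_of_eq_empty[OF assms(1), of B] assms(5) by blast
qed

lemma filter_base_on_finite_lower_bound:
  assumes \<B>: "filter_base_on X \<B>" and "finite \<C>" "\<C> \<subseteq> \<B>"
  shows "\<exists>B\<in>\<B>. B \<subseteq> \<Inter>\<C>"
  using assms(2,3)
proof (induction rule: finite_induct)
  case empty
  then show ?case using \<B> by (auto simp: filter_base_on_def)
next
  case (insert C \<C>)
  then obtain B where "B \<in> \<B>" "B \<subseteq> \<Inter>\<C>" by auto
  moreover from this obtain B' where "B' \<in> \<B>" "B' \<subseteq> B \<inter> C"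
    using \<B> insert.prems unfolding filter_base_on_def by (metis insert_subset)
  ultimately show ?case by auto
qed

lemma filter_base_on_range_decseq:
  assumes "decseq B" "\<And>n. B n \<noteq> {}" "\<And>n. B n \<subseteq> topspace X"
  shows "filter_base_on X (range B)"
proof -
  have "\<exists>k. B k \<subseteq> B m \<inter> B n" for m n
    using decseqD[OF assms(1)] by (meson Int_greatest max.cobounded1 max.cobounded2)
  then show ?thesis
    using assms(2,3) by (simp add: filter_base_on_def)
qed

lemma filter_base_on_meshes:
  assumes "filter_base_on X \<B>" "\<forall>W\<in>\<W>. \<exists>B\<in>\<B>. B \<subseteq> W"
  shows "meshes \<B> \<W>"
  unfolding meshes_def
proof (intro ballI)
  fix B W assume "B \<in> \<B>" "W \<in> \<W>"
  then obtain B' B'' where "B' \<subseteq> W" "B'' \<in> \<B>" "B'' \<subseteq> B \<inter> B'"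
    using assms unfolding filter_base_on_def by meson
  moreover have "B'' \<noteq> {}"
    using assms(1) \<open>B'' \<in> \<B>\<close> by (simp add: filter_base_on_def)
  ultimately show "B \<inter> W \<noteq> {}" by blast
qed

lemma filter_base_on_mesh_finite_UN:
  assumes \<B>: "filter_base_on X \<B>" and "finite E" and mesh: "\<forall>B\<in>\<B>. B \<inter> (\<Union>\<alpha>\<in>E. U \<alpha>) \<noteq> {}"
  shows "\<exists>\<alpha>\<in>E. \<forall>B\<in>\<B>. B \<inter> U \<alpha> \<noteq> {}"
proof (rule ccontr)
  assume "\<not> ?thesis"
  then obtain b where b: "\<And>\<alpha>. \<alpha> \<in> E \<Longrightarrow> b \<alpha> \<in> \<B> \<and> b \<alpha> \<inter> U \<alpha> = {}"
    by metis
  then obtain B where "B \<in> \<B>" "B \<subseteq> \<Inter>(b ` E)"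
    using filter_base_on_finite_lower_bound[OF \<B>, of "b ` E"] \<open>finite E\<close> by blast
  moreover from this b have "B \<inter> (\<Union>\<alpha>\<in>E. U \<alpha>) = {}"
    by blast
  ultimately show False
    using mesh by simp
qed

lemma filter_base_on_finite_Inters:
  assumes "C \<subseteq> topspace X" and fip: "\<And>\<F>. \<lbrakk>finite \<F>; \<F> \<subseteq> \<U>\<rbrakk> \<Longrightarrow> C \<inter> \<Inter>\<F> \<noteq> {}"
  shows "filter_base_on X {C \<inter> \<Inter>\<F> | \<F>. finite \<F> \<and> \<F> \<subseteq> \<U>}" (is "filter_base_on X ?\<B>")
  unfolding filter_base_on_def
proof (intro conjI ballI)
  show "?\<B> \<noteq> {}" by blast
next
  fix B assume "B \<in> ?\<B>"
  then show "B \<noteq> {}" "B \<subseteq> topspace X"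
    using assms by auto
next
  fix A B assume "A \<in> ?\<B>" "B \<in> ?\<B>"
  then obtain \<F> \<G> where "A = C \<inter> \<Inter>\<F>" "B = C \<inter> \<Inter>\<G>" and "finite (\<F> \<union> \<G>)" "\<F> \<union> \<G> \<subseteq> \<U>"
    by blast
  then show "\<exists>D\<in>?\<B>. D \<subseteq> A \<inter> B"
    by (intro bexI[of _ "C \<inter> \<Inter>(\<F> \<union> \<G>)"]) auto
qed

lemma compactin_adherence_nonempty:
  assumes C: "compactin X C" and "filter_base_on X \<B>" "\<Union>\<B> \<subseteq> C"
  shows "C \<inter> adherence X \<B> \<noteq> {}"
proof -
  have \<B>: "B \<noteq> {} \<and> B \<subseteq> C \<and> B \<subseteq> X closure_of B" if "B \<in> \<B>" for B
    using assms(2,3) that by (auto simp: filter_base_on_def closure_of_subset)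
  have "C \<inter> \<Inter>\<F> \<noteq> {}" if \<F>: "finite \<F>" "\<F> \<subseteq> (closure_of) X ` \<B>" for \<F>
  proof -
    obtain \<C> where \<C>: "finite \<C>" "\<C> \<subseteq> \<B>" "\<F> = (closure_of) X ` \<C>"
      using finite_subset_image[OF \<F>] by blast
    then obtain B where "B \<in> \<B>" "B \<subseteq> \<Inter>\<C>"
      using filter_base_on_finite_lower_bound[OF assms(2)] by blast
    then show ?thesis
      using \<B> \<C> by blast
  qed
  then show ?thesis
    using C unfolding compactin_fip adherence_def
    by (metis (no_types, lifting) closedin_closure_of imageE)
qed

lemma compactin_iff_adherence:
  "compactin X C \<longleftrightarrow> C \<subseteq> topspace X \<and>
     (\<forall>\<B>. filter_base_on X \<B> \<and> \<Union>\<B> \<subseteq> C \<longrightarrow> C \<inter> adherence X \<B> \<noteq> {})"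
proof (intro iffI conjI allI impI)
  assume C: "C \<subseteq> topspace X \<and>
    (\<forall>\<B>. filter_base_on X \<B> \<and> \<Union>\<B> \<subseteq> C \<longrightarrow> C \<inter> adherence X \<B> \<noteq> {})"
  have "C \<inter> \<Inter>\<U> \<noteq> {}"
    if closed: "\<forall>A\<in>\<U>. closedin X A" and fip: "\<forall>\<F>. finite \<F> \<and> \<F> \<subseteq> \<U> \<longrightarrow> C \<inter> \<Inter>\<F> \<noteq> {}" for \<U>
  proof -
    define \<B> where "\<B> = {C \<inter> \<Inter>\<F> | \<F>. finite \<F> \<and> \<F> \<subseteq> \<U>}"
    have "filter_base_on X \<B>"
      unfolding \<B>_def using C fip by (intro filter_base_on_finite_Inters) auto
    moreover have "\<Union>\<B> \<subseteq> C"
      by (auto simp: \<B>_def)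
    ultimately obtain x where x: "x \<in> C" "x \<in> adherence X \<B>"
      using C by blast
    have "x \<in> A" if A: "A \<in> \<U>" for A
    proof -
      have "C \<inter> \<Inter>{A} \<in> \<B>"
        using A unfolding \<B>_def by blast
      then have "x \<in> X closure_of (C \<inter> A)"
        using x(2) by (auto simp: adherence_def)
      then show ?thesis
        using closure_of_minimal[of "C \<inter> A" A X] closed A by blast
    qed
    then show ?thesis using x(1) by blast
  qed
  then show "compactin X C"
    using C by (simp add: compactin_fip)
qed (auto dest: compactin_subset_topspace compactin_adherence_nonempty)

definition open_supersets :: "'a topology \<Rightarrow> 'a set set \<Rightarrow> 'a set set" where
  "open_supersets X \<B> = {G. openin X G \<and> (\<exists>B\<in>\<B>. B \<subseteq> G)}"

lemma filter_base_on_open_supersets: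
  assumes \<B>: "filter_base_on X \<B>"
  shows "filter_base_on X (open_supersets X \<B>)"
  unfolding filter_base_on_def
proof (intro conjI ballI)
  have "topspace X \<in> open_supersets X \<B>"
    using \<B> by (auto simp: open_supersets_def filter_base_on_def)
  then show "open_supersets X \<B> \<noteq> {}" by blast
next
  fix G assume "G \<in> open_supersets X \<B>"
  then show "G \<noteq> {}" "G \<subseteq> topspace X"
    using \<B> by (auto simp: open_supersets_def filter_base_on_def openin_subset)
next
  fix G H assume "G \<in> open_supersets X \<B>" "H \<in> open_supersets X \<B>"
  then obtain A B where "A \<in> \<B>" "A \<subseteq> G" "B \<in> \<B>" "B \<subseteq> H" and "openin X (G \<inter> H)"
    unfolding open_supersets_def by blast
  moreover from this obtain D where "D \<in> \<B>" "D \<subseteq> A \<inter> B"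
    using \<B> unfolding filter_base_on_def by meson
  ultimately have "D \<in> \<B> \<and> D \<subseteq> G \<inter> H" by blast
  then have "G \<inter> H \<in> open_supersets X \<B>"
    using \<open>openin X (G \<inter> H)\<close> unfolding open_supersets_def by blast
  then show "\<exists>D\<in>open_supersets X \<B>. D \<subseteq> G \<inter> H" by blast
qed

lemma regular_space_adherence_open_supersets:
  assumes "regular_space X" and \<B>: "filter_base_on X \<B>"
  shows "adherence X (open_supersets X \<B>) = adherence X \<B>"
proof
  show "adherence X \<B> \<subseteq> adherence X (open_supersets X \<B>)"
    unfolding open_supersets_def by (intro adherence_antimono) blast
next
  show "adherence X (open_supersets X \<B>) \<subseteq> adherence X \<B>"
  proof (rule ccontr)
    assume "\<not> ?thesis"
    then obtain x B where x: "x \<in> adherence X (open_supersets X \<B>)"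
      and B: "B \<in> \<B>" "x \<notin> X closure_of B"
      by (auto simp: adherence_def)
    have "open_supersets X \<B> \<noteq> {}"
      using filter_base_on_open_supersets[OF \<B>] by (simp add: filter_base_on_def)
    then have "x \<in> topspace X"
      using x closedin_subset[OF closedin_adherence] by blast
    then obtain G H where "openin X G" "openin X H" "x \<in> G" "X closure_of B \<subseteq> H" "disjnt G H"
      using assms(1) B(2) unfolding regular_space_def by (metis DiffI closedin_closure_of)
    moreover have "B \<subseteq> X closure_of B"
      using \<B> B(1) by (simp add: closure_of_subset filter_base_on_def)
    ultimately have "H \<in> open_supersets X \<B>" "x \<in> G" "G \<inter> H = {}"
      using B(1) unfolding open_supersets_def disjnt_def by blast+
    moreover from this have "x \<in> X closure_of H"
      using x by (simp add: adherence_def)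
    ultimately show False
      using openin_Int_closure_of_eq_empty[OF \<open>openin X G\<close>, of H] by blast
  qed
qed

section \<open>Complete families\<close>

definition complete_family :: "'a topology \<Rightarrow> 'a set set \<Rightarrow> bool" where
  "complete_family X \<W> \<longleftrightarrow> (\<forall>\<B>. filter_base_on X \<B> \<and> meshes \<B> \<W> \<longrightarrow> adherence X \<B> \<noteq> {})"

lemma complete_family_refine:
  assumes "complete_family X \<W>" "\<forall>W\<in>\<W>. \<exists>V\<in>\<V>. V \<subseteq> W"
  shows "complete_family X \<V>"
proof -
  have "meshes \<B> \<W>" if mesh: "meshes \<B> \<V>" for \<B>
    unfolding meshes_def
  proof (intro ballI)
    fix B W assume "B \<in> \<B>" "W \<in> \<W>"
    moreover from this obtain V where "V \<in> \<V>" "V \<subseteq> W" using assms(2) by blast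
    ultimately show "B \<inter> W \<noteq> {}"
      using mesh unfolding meshes_def by blast
  qed
  then show ?thesis
    using assms(1) unfolding complete_family_def by blast
qed

text \<open>A filter base living on the adherence need not mesh with the family, but its open supersets
  do, and by regularity both have the same cluster points.\<close>

lemma compactin_adherence:
  assumes "regular_space X" and \<W>: "complete_family X \<W>" "\<W> \<noteq> {}"
  shows "compactin X (adherence X \<W>)"
  unfolding compactin_iff_adherence
proof (intro conjI allI impI)
  show "adherence X \<W> \<subseteq> topspace X"
    using \<W>(2) by (intro closedin_subset closedin_adherence)
next
  fix \<B> assume "filter_base_on X \<B> \<and> \<Union>\<B> \<subseteq> adherence X \<W>"
  then have \<B>: "filter_base_on X \<B>" "\<And>B. B \<in> \<B> \<Longrightarrow> B \<noteq> {} \<and> B \<subseteq> adherence X \<W>"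
    by (auto simp: filter_base_on_def)
  have "meshes (open_supersets X \<B>) \<W>"
    unfolding meshes_def
  proof (intro ballI)
    fix G W assume "G \<in> open_supersets X \<B>" "W \<in> \<W>"
    then have "openin X G" "G \<inter> X closure_of W \<noteq> {}"
      using \<B>(2) by (auto simp: open_supersets_def adherence_def) blast
    then show "G \<inter> W \<noteq> {}"
      by (simp add: openin_Int_closure_of_eq_empty)
  qed
  then have "adherence X \<B> \<noteq> {}"
    using \<W>(1) filter_base_on_open_supersets[OF \<B>(1)]
      regular_space_adherence_open_supersets[OF assms(1) \<B>(1)]
    unfolding complete_family_def by metis
  moreover have "adherence X \<B> \<subseteq> adherence X \<W>"
  proof -
    obtain B where "B \<in> \<B>"
      using \<B>(1) by (auto simp: filter_base_on_def)
    then have "X closure_of B \<subseteq> adherence X \<W>"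
      using \<B>(2) \<W>(2) by (intro closure_of_minimal closedin_adherence) auto
    then show ?thesis
      using \<open>B \<in> \<B>\<close> by (auto simp: adherence_def)
  qed
  ultimately show "adherence X \<W> \<inter> adherence X \<B> \<noteq> {}" by blast
qed

lemma compactin_nhds_imp_complete_family:
  assumes C: "compactin X C" and nhds: "\<And>G. \<lbrakk>openin X G; C \<subseteq> G\<rbrakk> \<Longrightarrow> \<exists>W\<in>\<W>. W \<subseteq> G"
  shows "complete_family X \<W>"
  unfolding complete_family_def
proof (intro allI impI)
  fix \<B> assume \<B>: "filter_base_on X \<B> \<and> meshes \<B> \<W>"
  let ?trace = "\<lambda>B. C \<inter> X closure_of B"
  have nonempty: "?trace B \<noteq> {}" if B: "B \<in> \<B>" for B
  proof
    assume "?trace B = {}"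
    then have "C \<subseteq> topspace X - X closure_of B"
      using compactin_subset_topspace[OF C] by blast
    then obtain W where "W \<in> \<W>" "W \<subseteq> topspace X - X closure_of B"
      using nhds by (meson closedin_closure_of openin_diff openin_topspace)
    moreover have "B \<subseteq> X closure_of B"
      using \<B> B by (simp add: closure_of_subset filter_base_on_def)
    ultimately show False
      using \<B> B unfolding meshes_def by blast
  qed
  have "\<exists>D\<in>\<B>. ?trace D \<subseteq> ?trace A \<inter> ?trace B" if members: "A \<in> \<B>" "B \<in> \<B>" for A B
  proof -
    obtain D where "D \<in> \<B>" "D \<subseteq> A" "D \<subseteq> B"
      using \<B> members unfolding filter_base_on_def by (meson le_inf_iff)
    moreover from this have "?trace D \<subseteq> ?trace A \<inter> ?trace B"
      using closure_of_mono[of D _ X] by blast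
    ultimately show ?thesis by blast
  qed
  then have "filter_base_on X (?trace ` \<B>)"
    using \<B> nonempty compactin_subset_topspace[OF C] by (auto simp: filter_base_on_def)
  moreover have "\<Union>(?trace ` \<B>) \<subseteq> C"
    by blast
  ultimately have "adherence X (?trace ` \<B>) \<noteq> {}"
    using compactin_adherence_nonempty[OF C] by blast
  moreover have "X closure_of (?trace B) \<subseteq> X closure_of B" for B
    by (intro closure_of_minimal) auto
  then have "adherence X (?trace ` \<B>) \<subseteq> adherence X \<B>"
    by (auto simp: adherence_def)
  ultimately show "adherence X \<B> \<noteq> {}" by blast
qed

lemma complete_decseq_eventually_subset:
  assumes W: "complete_family X (range W)" "decseq W" "\<And>n. W n \<subseteq> topspace X"
    and G: "openin X G" "adherence X (range W) \<subseteq> G"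
  shows "\<exists>n. W n \<subseteq> G"
proof (rule ccontr)
  assume outside: "\<nexists>n. W n \<subseteq> G"
  let ?\<B> = "range (\<lambda>n. W n - G)"
  have "filter_base_on X ?\<B>"
  proof (rule filter_base_on_range_decseq)
    show "decseq (\<lambda>n. W n - G)"
      using W(2) by (auto simp: decseq_def)
  qed (use outside W(3) in blast)+
  moreover have finer: "\<forall>V\<in>range W. \<exists>B\<in>?\<B>. B \<subseteq> V"
    by blast
  ultimately have "adherence X ?\<B> \<noteq> {}"
    using W(1) filter_base_on_meshes unfolding complete_family_def by blast
  then show False
    using adherence_empty_if_disjoint_open[OF G finer, of "W 0 - G"] by blast
qed

lemma complete_decseq_compactin_Un:
  assumes "regular_space X"
    and W: "complete_family X (range W)" "decseq W" "\<And>n. W n \<subseteq> topspace X"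
    and K: "\<And>n. compactin X (K n)" "\<And>n. K n \<subseteq> W n"
  shows "compactin X (adherence X (range W) \<union> (\<Union>n. K n))"
  unfolding compactin_def
proof (intro conjI allI impI)
  have compact: "compactin X (adherence X (range W))"
    using assms(1) W(1) by (rule compactin_adherence) simp
  then show "adherence X (range W) \<union> (\<Union>n. K n) \<subseteq> topspace X"
    using K(1) by (auto dest: compactin_subset_topspace)
  fix \<U> assume \<U>: "(\<forall>U\<in>\<U>. openin X U) \<and> adherence X (range W) \<union> (\<Union>n. K n) \<subseteq> \<Union>\<U>"
  then obtain \<F> where \<F>: "finite \<F>" "\<F> \<subseteq> \<U>" "adherence X (range W) \<subseteq> \<Union>\<F>"
    using compact unfolding compactin_def by (metis Un_subset_iff)
  then have "openin X (\<Union>\<F>)"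
    using \<U> by blast
  then obtain n where n: "W n \<subseteq> \<Union>\<F>"
    using complete_decseq_eventually_subset[OF W] \<F>(3) by blast
  have "compactin X (\<Union>m<n. K m)"
    using K(1) by (intro compactin_Union) auto
  moreover have "(\<Union>m<n. K m) \<subseteq> \<Union>\<U>"
    using \<U> by blast
  ultimately obtain \<G> where \<G>: "finite \<G>" "\<G> \<subseteq> \<U>" "(\<Union>m<n. K m) \<subseteq> \<Union>\<G>"
    using \<U> unfolding compactin_def by meson
  have "K m \<subseteq> \<Union>\<F> \<union> \<Union>\<G>" for m
  proof (cases "m < n")
    case False
    then have "W m \<subseteq> W n"
      using decseqD[OF W(2)] by simp
    then show ?thesis using n K(2)[of m] by blast
  qed (use \<G> in blast)
  then show "\<exists>\<F>. finite \<F> \<and> \<F> \<subseteq> \<U> \<and> adherence X (range W) \<union> (\<Union>n. K n) \<subseteq> \<Union>\<F>"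
    using \<F> \<G> by (intro exI[of _ "\<F> \<union> \<G>"]) auto
qed

definition selections_in_compact :: "'a topology \<Rightarrow> (nat \<Rightarrow> 'a set) \<Rightarrow> bool" where
  "selections_in_compact X V \<longleftrightarrow>
     (\<forall>y. (\<forall>n. y n \<in> V n) \<longrightarrow> (\<exists>C. compactin X C \<and> range y \<subseteq> C))"

lemma selections_in_compact_eventually_subset:
  assumes V: "selections_in_compact X V" "decseq V"
    and G: "openin X G" "adherence X (range V) \<subseteq> G"
  shows "\<exists>n. V n \<subseteq> G"
proof (rule ccontr)
  assume "\<nexists>n. V n \<subseteq> G"
  then have "\<forall>n. \<exists>y. y \<in> V n - G" by blast
  then obtain y where y: "\<And>n. y n \<in> V n - G" by metis
  then obtain C where C: "compactin X C" "range y \<subseteq> C"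
    using V(1) unfolding selections_in_compact_def by blast
  let ?\<B> = "range (\<lambda>n. y ` {n..})"
  have "filter_base_on X ?\<B>"
  proof (rule filter_base_on_range_decseq)
    show "decseq (\<lambda>n. y ` {n..})"
      by (intro decseq_SucI image_mono) auto
  qed (use C compactin_subset_topspace in blast)+
  moreover have "\<Union>?\<B> \<subseteq> C"
    using C(2) by blast
  ultimately have "adherence X ?\<B> \<noteq> {}"
    using compactin_adherence_nonempty[OF C(1)] by blast
  moreover have "y ` {n..} \<subseteq> V n" for n
    using y decseqD[OF V(2)] by blast
  then have "\<forall>U\<in>range V. \<exists>B\<in>?\<B>. B \<subseteq> U"
    by blast
  then have "adherence X ?\<B> = {}"
    using y by (intro adherence_empty_if_disjoint_open[OF G _ rangeI[of _ 0]]) auto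
  ultimately show False by blast
qed

lemma boundedin_space_adherence:
  assumes "selections_in_compact X V"
  shows "boundedin_space X (adherence X (range V))"
  unfolding boundedin_space_def
proof (intro conjI allI impI)
  show "adherence X (range V) \<subseteq> topspace X"
    by (intro closedin_subset closedin_adherence) simp
next
  fix f assume f: "continuous_map X euclideanreal f"
  show "bounded (f ` adherence X (range V))"
  proof (rule ccontr)
    assume unbounded: "\<not> bounded (f ` adherence X (range V))"
    have "\<exists>y\<in>V n. real n < \<bar>f y\<bar>" for n
    proof -
      let ?G = "{x \<in> topspace X. f x \<in> {t. real n < \<bar>t\<bar>}}"
      obtain x where "x \<in> adherence X (range V)" "real n < \<bar>f x\<bar>"
        using unbounded by (force simp: bounded_iff not_le)
      then have "x \<in> ?G \<inter> X closure_of V n"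
        by (auto simp: adherence_def in_closure_of)
      moreover have "open {t. real n < \<bar>t\<bar>}"
        by (intro open_Collect_less continuous_intros)
      then have "openin X ?G"
        by (intro openin_continuous_map_preimage[OF f]) simp
      ultimately have "?G \<inter> V n \<noteq> {}"
        using openin_Int_closure_of_eq_empty by blast
      then show ?thesis by blast
    qed
    then obtain y where y: "\<And>n. y n \<in> V n" "\<And>n. real n < \<bar>f (y n)\<bar>" by metis
    then obtain C where C: "compactin X C" "range y \<subseteq> C"
      using assms unfolding selections_in_compact_def by blast
    have "bounded (f ` C)"
      using image_compactin[OF C(1) f] by (simp add: compact_imp_bounded)
    then obtain b where "\<And>n. \<bar>f (y n)\<bar> \<le> b"
      using C(2) by (force simp: bounded_iff)
    moreover obtain n where "b < real n" using reals_Archimedean2 by blast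
    ultimately show False
      using y(2)[of n] by (meson less_le_trans not_less order.strict_trans)
  qed
qed

lemma mu_space_complete_decseq:
  assumes "mu_space X" and V: "selections_in_compact X V" "decseq V"
  shows "complete_family X (range V)"
proof (rule compactin_nhds_imp_complete_family)
  show "compactin X (adherence X (range V))"
    using assms(1) boundedin_space_adherence[OF V(1)] closedin_adherence
    unfolding mu_space_def by blast
  show "\<exists>U\<in>range V. U \<subseteq> G" if "openin X G" "adherence X (range V) \<subseteq> G" for G
    using selections_in_compact_eventually_subset[OF V that] by blast
qed

section \<open>Koenig's lemma\<close>

lemma decseq_finite_nonempty_INT:
  assumes "decseq A" "\<And>n. finite (A n)" "\<And>n. A n \<noteq> {}"
  shows "(\<Inter>n. A n) \<noteq> {}"
proof -
  obtain m where least: "\<And>n. card (A m) \<le> card (A n)"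
    using ex_has_least_nat[of "\<lambda>_. True" 0 "\<lambda>n. card (A n)"] by blast
  have "A m \<subseteq> A n" for n
  proof (cases "n \<le> m")
    case False
    then have "A n = A m"
      using decseqD[OF assms(1), of m n] assms(2) least by (intro card_seteq) auto
    then show ?thesis by simp
  qed (use decseqD[OF assms(1)] in blast)
  then show ?thesis
    using assms(3)[of m] by blast
qed

lemma finite_inverse_system_surjective_core:
  assumes fin: "\<And>n. finite (G n)" and nonempty: "\<And>n. G n \<noteq> {}"
    and p: "\<And>n. p n ` G (Suc n) \<subseteq> G n"
  shows "\<exists>D. \<forall>n. D n \<noteq> {} \<and> D n \<subseteq> G n \<and> D n \<subseteq> p n ` D (Suc n)"
proof -
  define desc where "desc = rec_nat G (\<lambda>_ D n. p n ` D (Suc n))"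
  have desc_simps: "desc 0 n = G n" "desc (Suc k) n = p n ` desc k (Suc n)" for k n
    by (simp_all add: desc_def)
  have desc_fin: "finite (desc k n)" and desc_nonempty: "desc k n \<noteq> {}" for k n
    by (induction k arbitrary: n) (simp_all add: desc_simps fin nonempty)
  have "desc (Suc k) n \<subseteq> desc k n" for k n
  proof (induction k arbitrary: n)
    case 0
    then show ?case using p by (simp add: desc_simps)
  next
    case (Suc k)
    then show ?case by (metis desc_simps(2) image_mono)
  qed
  then have desc_decseq: "decseq (\<lambda>k. desc k n)" for n
    by (rule decseq_SucI)
  define D where "D n = (\<Inter>k. desc k n)" for n
  have "\<alpha> \<in> p n ` D (Suc n)" if \<alpha>: "\<alpha> \<in> D n" for n \<alpha>
  proof -
    have "\<alpha> \<in> p n ` desc k (Suc n)" for k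
      using \<alpha> desc_simps(2) unfolding D_def by (metis INT_D UNIV_I)
    then have "(\<Inter>k. {\<beta> \<in> desc k (Suc n). p n \<beta> = \<alpha>}) \<noteq> {}"
      using desc_decseq[of "Suc n"] desc_fin
      by (intro decseq_finite_nonempty_INT) (auto simp: decseq_def)
    then show ?thesis by (auto simp: D_def)
  qed
  moreover have "D n \<noteq> {}" for n
    unfolding D_def using desc_decseq desc_fin desc_nonempty by (rule decseq_finite_nonempty_INT)
  moreover have "D n \<subseteq> G n" for n
    unfolding D_def using desc_simps(1) by blast
  ultimately have "\<forall>n. D n \<noteq> {} \<and> D n \<subseteq> G n \<and> D n \<subseteq> p n ` D (Suc n)"
    by (simp add: subsetI)
  then show ?thesis by (rule exI[of _ D])
qed

lemma koenig_inverse_limit: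
  assumes "\<And>n. finite (G n)" "\<And>n. G n \<noteq> {}" "\<And>n. p n ` G (Suc n) \<subseteq> G n"
  shows "\<exists>c. (\<forall>n. c n \<in> G n) \<and> (\<forall>n. p n (c (Suc n)) = c n)"
proof -
  obtain D where D: "\<And>n. D n \<noteq> {}" "\<And>n. D n \<subseteq> G n" "\<And>n. D n \<subseteq> p n ` D (Suc n)"
    using finite_inverse_system_surjective_core[of G p] assms by metis
  have "\<exists>c. \<forall>n. c n \<in> D n \<and> p n (c (Suc n)) = c n"
  proof (rule dependent_nat_choice)
    show "\<exists>\<alpha>. \<alpha> \<in> D 0"
      using D(1) by blast
    show "\<exists>\<beta>. \<beta> \<in> D (Suc n) \<and> p n \<beta> = \<alpha>" if "\<alpha> \<in> D n" for \<alpha> n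
      using D(3)[of n] that by blast
  qed
  then show ?thesis
    using D(2) by blast
qed

section \<open>Sieves\<close>

lemma complete_sieve_iff_complete_family:
  "complete_sieve X I U p \<longleftrightarrow> is_sieve X I U p \<and>
     (\<forall>c. pi_chain I p c \<longrightarrow> complete_family X (range (\<lambda>n. U n (c n))))"
proof -
  have "complete_family X (range (\<lambda>n. U n (c n))) \<longleftrightarrow>
      (\<forall>\<B>. filter_base_on X \<B> \<and> (\<forall>B\<in>\<B>. \<forall>n. B \<inter> U n (c n) \<noteq> {}) \<longrightarrow>
        (\<exists>x\<in>topspace X. \<forall>B\<in>\<B>. x \<in> X closure_of B))" for c
    by (simp add: complete_family_def meshes_def adherence_nonempty_iff)
  then show ?thesis
    by (simp only: complete_sieve_def imp_conjL all_simps)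
qed

lemma complete_sieve_imp_is_sieve: "complete_sieve X I U p \<Longrightarrow> is_sieve X I U p"
  by (simp add: complete_sieve_def)

lemma is_sieve_openin: "\<lbrakk>is_sieve X I U p; \<alpha> \<in> I n\<rbrakk> \<Longrightarrow> openin X (U n \<alpha>)"
  unfolding is_sieve_def by (elim conjE) simp

lemma is_sieve_cover: "is_sieve X I U p \<Longrightarrow> (\<Union>\<alpha>\<in>I n. U n \<alpha>) = topspace X"
  unfolding is_sieve_def by iprover

lemma is_sieve_parent: "\<lbrakk>is_sieve X I U p; \<beta> \<in> I (Suc n)\<rbrakk> \<Longrightarrow> p n \<beta> \<in> I n"
  unfolding is_sieve_def by (elim conjE) simp

lemma is_sieve_children:
  assumes "is_sieve X I U p" "\<alpha> \<in> I n"
  shows "U n \<alpha> = (\<Union>\<beta>\<in>{\<beta> \<in> I (Suc n). p n \<beta> = \<alpha>}. U (Suc n) \<beta>)"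
proof -
  have "U n \<alpha> = \<Union>{U (Suc n) \<beta> | \<beta>. \<beta> \<in> I (Suc n) \<and> p n \<beta> = \<alpha>}"
    using assms unfolding is_sieve_def by blast
  then show ?thesis by blast
qed

lemma is_sieve_subset_parent:
  assumes "is_sieve X I U p" "\<beta> \<in> I (Suc n)"
  shows "U (Suc n) \<beta> \<subseteq> U n (p n \<beta>)"
  by (subst is_sieve_children[OF assms(1) is_sieve_parent[OF assms]])
    (rule UN_upper, simp add: assms(2))

lemma pi_chain_decseq:
  assumes "is_sieve X I U p" "pi_chain I p c"
  shows "decseq (\<lambda>n. U n (c n))"
  using is_sieve_subset_parent[OF assms(1)] assms(2)
  by (intro decseq_SucI) (metis pi_chain_def)

lemma is_sieve_pi_chain_through:
  assumes S: "is_sieve X I U p" and x: "x \<in> topspace X"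
  shows "\<exists>c. pi_chain I p c \<and> (\<forall>n. x \<in> U n (c n))"
proof -
  have "\<exists>c. \<forall>n. (c n \<in> I n \<and> x \<in> U n (c n)) \<and> p n (c (Suc n)) = c n"
  proof (rule dependent_nat_choice)
    show "\<exists>\<alpha>. \<alpha> \<in> I 0 \<and> x \<in> U 0 \<alpha>"
      using is_sieve_cover[OF S, of 0] x by blast
    show "\<exists>\<beta>. (\<beta> \<in> I (Suc n) \<and> x \<in> U (Suc n) \<beta>) \<and> p n \<beta> = \<alpha>" if "\<alpha> \<in> I n \<and> x \<in> U n \<alpha>" for \<alpha> n
      using is_sieve_children[OF S, of \<alpha> n] that by blast
  qed
  then show ?thesis
    unfolding pi_chain_def by blast
qed

definition reindex_sets ::
    "('i \<Rightarrow> 'j) \<Rightarrow> (nat \<Rightarrow> 'i set) \<Rightarrow> (nat \<Rightarrow> 'i \<Rightarrow> 'a set) \<Rightarrow> nat \<Rightarrow> 'j \<Rightarrow> 'a set" where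
  "reindex_sets f I U n \<beta> = U n (inv_into (I n) f \<beta>)"

definition reindex_parent ::
    "('i \<Rightarrow> 'j) \<Rightarrow> (nat \<Rightarrow> 'i set) \<Rightarrow> (nat \<Rightarrow> 'i \<Rightarrow> 'i) \<Rightarrow> nat \<Rightarrow> 'j \<Rightarrow> 'j" where
  "reindex_parent f I p n \<beta> = f (p n (inv_into (I (Suc n)) f \<beta>))"

lemma is_sieve_inj_reindex:
  assumes sieve: "is_sieve X I U p" and f: "\<And>n. inj_on f (I n)"
  shows "is_sieve X (\<lambda>n. f ` I n) (reindex_sets f I U) (reindex_parent f I p)"
    (is "is_sieve X ?J ?V ?q")
  unfolding is_sieve_def
proof (intro conjI allI ballI)
  have V: "?V n (f \<alpha>) = U n \<alpha>" if "\<alpha> \<in> I n" for n \<alpha>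
    using f that by (simp add: reindex_sets_def)
  have q: "?q n (f \<beta>) = f (p n \<beta>)" if "\<beta> \<in> I (Suc n)" for n \<beta>
    using f that by (simp add: reindex_parent_def)
  show "openin X (?V n \<beta>)" if "\<beta> \<in> ?J n" for n \<beta>
    using that is_sieve_openin[OF sieve] by (auto simp: V)
  show "\<Union>(?V n ` ?J n) = topspace X" for n
    using is_sieve_cover[OF sieve, of n] by (simp add: image_image V)
  show "?q n \<beta> \<in> ?J n" if "\<beta> \<in> ?J (Suc n)" for n \<beta>
    using that is_sieve_parent[OF sieve] by (auto simp: q)
  show "?V n \<beta> = \<Union>{?V (Suc n) \<gamma> | \<gamma>. \<gamma> \<in> ?J (Suc n) \<and> ?q n \<gamma> = \<beta>}" if \<beta>: "\<beta> \<in> ?J n" for n \<beta>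
  proof -
    obtain \<alpha> where \<alpha>: "\<alpha> \<in> I n" "\<beta> = f \<alpha>" using \<beta> by blast
    have "?q n (f \<gamma>) = f \<alpha> \<longleftrightarrow> p n \<gamma> = \<alpha>" if "\<gamma> \<in> I (Suc n)" for \<gamma>
      using f \<alpha>(1) is_sieve_parent[OF sieve that] q[OF that] by (metis inj_on_eq_iff)
    then have "{?V (Suc n) \<gamma> | \<gamma>. \<gamma> \<in> ?J (Suc n) \<and> ?q n \<gamma> = \<beta>}
        = U (Suc n) ` {\<gamma> \<in> I (Suc n). p n \<gamma> = \<alpha>}"
      unfolding \<alpha>(2) by (force simp: V)
    then show ?thesis
      using is_sieve_children[OF sieve \<alpha>(1)] \<alpha> by (simp add: V)
  qed
qed

lemma complete_sieve_inj_reindex: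
  assumes S: "complete_sieve X I U p" and f: "\<And>n. inj_on f (I n)"
  shows "complete_sieve X (\<lambda>n. f ` I n) (reindex_sets f I U) (reindex_parent f I p)"
    (is "complete_sieve X ?J ?V ?q")
proof -
  have sieve: "is_sieve X I U p"
    using S by (rule complete_sieve_imp_is_sieve)
  have "complete_family X (range (\<lambda>n. ?V n (c n)))" if c: "pi_chain ?J ?q c" for c
  proof -
    have inv_I: "inv_into (I n) f (c n) \<in> I n" for n
      using c by (simp add: pi_chain_def inv_into_into)
    have "p n (inv_into (I (Suc n)) f (c (Suc n))) = inv_into (I n) f (c n)" for n
      using c is_sieve_parent[OF sieve inv_I] f
      unfolding pi_chain_def reindex_parent_def by (metis inv_into_f_f)
    then have "pi_chain I p (\<lambda>n. inv_into (I n) f (c n))"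
      using inv_I by (simp add: pi_chain_def)
    then show ?thesis
      using S by (simp add: complete_sieve_iff_complete_family reindex_sets_def)
  qed
  then show ?thesis
    using is_sieve_inj_reindex[OF sieve f] unfolding complete_sieve_iff_complete_family by blast
qed

definition refinements :: "(nat \<Rightarrow> 'i set) \<Rightarrow> (nat \<Rightarrow> 'i \<Rightarrow> 'i) \<Rightarrow> nat \<Rightarrow> 'i set \<Rightarrow> 'i set set" where
  "refinements I p n E = {E' \<in> Fpow (I (Suc n)). p n ` E' \<subseteq> E}"

lemma refinements_UN_subset:
  assumes "is_sieve X I U p" "E' \<in> refinements I p n E"
  shows "(\<Union>\<beta>\<in>E'. U (Suc n) \<beta>) \<subseteq> (\<Union>\<alpha>\<in>E. U n \<alpha>)"
proof (rule UN_least)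
  fix \<beta> assume "\<beta> \<in> E'"
  then have "\<beta> \<in> I (Suc n)" "p n \<beta> \<in> E"
    using assms(2) by (auto simp: refinements_def Fpow_def)
  then show "U (Suc n) \<beta> \<subseteq> (\<Union>\<alpha>\<in>E. U n \<alpha>)"
    using is_sieve_subset_parent[OF assms(1)] by blast
qed

lemma complete_sieve_finite_unions:
  assumes S: "complete_sieve X I U p"
    and E: "\<And>n. E n \<in> Fpow (I n)" "\<And>n. E (Suc n) \<in> refinements I p n (E n)"
  shows "complete_family X (range (\<lambda>n. \<Union>\<alpha>\<in>E n. U n \<alpha>))"
  unfolding complete_family_def
proof (intro allI impI, elim conjE)
  fix \<B> assume \<B>: "filter_base_on X \<B>" and mesh: "meshes \<B> (range (\<lambda>n. \<Union>\<alpha>\<in>E n. U n \<alpha>))"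
  have sieve: "is_sieve X I U p"
    using S by (rule complete_sieve_imp_is_sieve)
  have E_level: "finite (E n)" "E n \<subseteq> I n" "p n ` E (Suc n) \<subseteq> E n" for n
    using E by (auto simp: Fpow_def refinements_def)
  define G where "G n = {\<alpha> \<in> E n. \<forall>B\<in>\<B>. B \<inter> U n \<alpha> \<noteq> {}}" for n
  have "\<exists>c. (\<forall>n. c n \<in> G n) \<and> (\<forall>n. p n (c (Suc n)) = c n)"
  proof (rule koenig_inverse_limit)
    show "finite (G n)" for n
      using E_level(1) by (simp add: G_def)
    show "G n \<noteq> {}" for n
      using filter_base_on_mesh_finite_UN[OF \<B> E_level(1)[of n], where U = "U n"] mesh
      by (auto simp: G_def meshes_def)
    have "U (Suc n) \<beta> \<subseteq> U n (p n \<beta>)" if "\<beta> \<in> E (Suc n)" for n \<beta>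
      using is_sieve_subset_parent[OF sieve] E_level(2) that by blast
    then show "p n ` G (Suc n) \<subseteq> G n" for n
      using E_level(3)[of n] unfolding G_def by fastforce
  qed
  then obtain c where c: "\<And>n. c n \<in> G n" "\<And>n. p n (c (Suc n)) = c n" by blast
  moreover have "G n \<subseteq> I n" for n
    using E_level(2) by (auto simp: G_def)
  ultimately have "pi_chain I p c"
    unfolding pi_chain_def by blast
  then have "complete_family X (range (\<lambda>n. U n (c n)))"
    using S by (simp add: complete_sieve_iff_complete_family)
  moreover have "meshes \<B> (range (\<lambda>n. U n (c n)))"
    using c(1) by (auto simp: meshes_def G_def)
  ultimately show "adherence X \<B> \<noteq> {}"
    using \<B> unfolding complete_family_def by blast
qed

text \<open>In a sieve every member has one parent. When a set may refine several sets of the previous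
  level, the sieve is indexed by the paths leading to it, listed backwards.\<close>

primrec histories :: "'x set \<Rightarrow> (nat \<Rightarrow> 'x \<Rightarrow> 'x set) \<Rightarrow> nat \<Rightarrow> 'x list set" where
  "histories A ch 0 = (\<lambda>x. [x]) ` A"
| "histories A ch (Suc n) = (\<Union>xs\<in>histories A ch n. (\<lambda>y. y # xs) ` ch n (hd xs))"

lemma length_histories: "xs \<in> histories A ch n \<Longrightarrow> length xs = Suc n"
  by (induction n arbitrary: xs) auto

lemma hd_histories:
  assumes "A \<subseteq> N 0" "\<And>n x. x \<in> N n \<Longrightarrow> ch n x \<subseteq> N (Suc n)" and "xs \<in> histories A ch n"
  shows "hd xs \<in> N n"
  using assms(3)
proof (induction n arbitrary: xs)
  case 0
  then show ?case using assms(1) by auto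
next
  case (Suc n)
  then obtain y ys where "xs = y # ys" "ys \<in> histories A ch n" "y \<in> ch n (hd ys)"
    by auto
  then show ?case
    using Suc.IH assms(2) by fastforce
qed

lemma is_sieve_histories:
  assumes A: "A \<subseteq> N 0" "topspace X = (\<Union>x\<in>A. V 0 x)"
    and V: "\<And>n x. x \<in> N n \<Longrightarrow> openin X (V n x)"
      "\<And>n x. x \<in> N n \<Longrightarrow> V n x = (\<Union>y\<in>ch n x. V (Suc n) y)"
    and ch: "\<And>n x. x \<in> N n \<Longrightarrow> ch n x \<subseteq> N (Suc n)"
  shows "is_sieve X (histories A ch) (\<lambda>n xs. V n (hd xs)) (\<lambda>_. tl)"
  unfolding is_sieve_def
proof (intro conjI allI ballI)
  let ?H = "histories A ch"
  have hd: "hd xs \<in> N n" if "xs \<in> ?H n" for xs n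
    using A(1) ch that by (rule hd_histories)
  show "openin X (V n (hd xs))" if "xs \<in> ?H n" for n xs
    using V(1) hd[OF that] by blast
  show "(\<Union>xs\<in>?H n. V n (hd xs)) = topspace X" for n
  proof (induction n)
    case 0
    then show ?case using A(2) by simp
  next
    case (Suc n)
    have "(\<Union>xs\<in>?H (Suc n). V (Suc n) (hd xs)) = (\<Union>xs\<in>?H n. \<Union>y\<in>ch n (hd xs). V (Suc n) y)"
      by simp
    also have "\<dots> = (\<Union>xs\<in>?H n. V n (hd xs))"
      using V(2)[OF hd] by simp
    finally show ?case using Suc.IH by simp
  qed
  show "tl xs \<in> ?H n" if "xs \<in> ?H (Suc n)" for n xs
    using that by auto
  show "V n (hd xs) = \<Union>{V (Suc n) (hd ys) | ys. ys \<in> ?H (Suc n) \<and> tl ys = xs}"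
    if "xs \<in> ?H n" for n xs
  proof -
    have "{V (Suc n) (hd ys) | ys. ys \<in> ?H (Suc n) \<and> tl ys = xs} = V (Suc n) ` ch n (hd xs)"
      using that by force
    then show ?thesis
      using V(2)[OF hd[OF that]] by simp
  qed
qed

lemma complete_sieve_histories:
  assumes A: "A \<subseteq> N 0" "topspace X = (\<Union>x\<in>A. V 0 x)"
    and V: "\<And>n x. x \<in> N n \<Longrightarrow> openin X (V n x)"
      "\<And>n x. x \<in> N n \<Longrightarrow> V n x = (\<Union>y\<in>ch n x. V (Suc n) y)"
    and ch: "\<And>n x. x \<in> N n \<Longrightarrow> ch n x \<subseteq> N (Suc n)"
    and complete: "\<And>x. \<lbrakk>\<And>n. x n \<in> N n; \<And>n. x (Suc n) \<in> ch n (x n)\<rbrakk>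
      \<Longrightarrow> complete_family X (range (\<lambda>n. V n (x n)))"
  shows "complete_sieve X (histories A ch) (\<lambda>n xs. V n (hd xs)) (\<lambda>_. tl)"
proof -
  let ?H = "histories A ch"
  have "complete_family X (range (\<lambda>n. V n (hd (c n))))" if c: "pi_chain ?H (\<lambda>_. tl) c" for c
  proof (rule complete)
    have c_H: "c n \<in> ?H n" and c_tl: "tl (c (Suc n)) = c n" for n
      using c by (simp_all add: pi_chain_def)
    show "hd (c n) \<in> N n" for n
      using A(1) ch c_H by (rule hd_histories)
    show "hd (c (Suc n)) \<in> ch n (hd (c n))" for n
      using c_H[of "Suc n"] c_tl[of n] by auto
  qed
  moreover have "is_sieve X ?H (\<lambda>n xs. V n (hd xs)) (\<lambda>_. tl)"
    using A V ch by (rule is_sieve_histories)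
  ultimately show ?thesis
    unfolding complete_sieve_iff_complete_family by blast
qed

section \<open>The Lindelof number\<close>

lemma lepoll_UN_infinite:
  fixes A :: "'c \<Rightarrow> 'd set"
  assumes "infinite K" "I \<lesssim> K" "\<And>i. i \<in> I \<Longrightarrow> A i \<lesssim> K"
  shows "(\<Union>i\<in>I. A i) \<lesssim> K"
  using assms unfolding lepoll_def card_of_ordLeq
  by (intro card_of_UNION_ordLeq_infinite) auto

lemma Fpow_lepoll_infinite:
  assumes "infinite K" "A \<lesssim> K"
  shows "Fpow A \<lesssim> K"
proof -
  obtain f where "inj_on f A" "f ` A \<subseteq> K"
    using assms(2) unfolding lepoll_def by blast
  then have "Fpow A \<lesssim> Fpow K"
    unfolding lepoll_def by (meson image_Fpow_mono inj_on_image_Fpow)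
  also have "Fpow K \<approx> K"
    using assms(1) by (rule eqpoll_Fpow)
  finally show ?thesis .
qed

lemma histories_lepoll:
  assumes "infinite K" "A \<lesssim> K" "A \<subseteq> N 0"
    and ch: "\<And>n x. x \<in> N n \<Longrightarrow> ch n x \<subseteq> N (Suc n)" "\<And>n x. x \<in> N n \<Longrightarrow> ch n x \<lesssim> K"
  shows "histories A ch n \<lesssim> K"
proof (induction n)
  case 0
  then show ?case
    using lepoll_trans[OF image_lepoll assms(2)] by simp
next
  case (Suc n)
  have "hd xs \<in> N n" if "xs \<in> histories A ch n" for xs
    using assms(3) ch(1) that by (rule hd_histories)
  then have "(\<lambda>y. y # xs) ` ch n (hd xs) \<lesssim> K" if "xs \<in> histories A ch n" for xs
    using lepoll_trans[OF image_lepoll ch(2)] that by blast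
  then show ?case
    using assms(1) Suc.IH by (simp add: lepoll_UN_infinite)
qed

lemma histories_refinements_lepoll:
  assumes "infinite K" "\<And>n. I n \<lesssim> K"
  shows "histories (Fpow (I 0)) (refinements I p) n \<lesssim> K"
proof (rule histories_lepoll[OF assms(1), where N = "\<lambda>n. Fpow (I n)"])
  show Fpow: "Fpow (I m) \<lesssim> K" for m
    using assms by (rule Fpow_lepoll_infinite)
  show refinements: "refinements I p m E \<subseteq> Fpow (I (Suc m))" for m E
    by (auto simp: refinements_def)
  show "refinements I p m E \<lesssim> K" for m E
    by (rule lepoll_trans[OF subset_imp_lepoll[OF refinements] Fpow])
qed simp

lemma lindelof_le_closedin:
  assumes K: "lindelof_le X K" and C: "closedin X C"
    and \<U>: "\<And>U. U \<in> \<U> \<Longrightarrow> openin X U" "C \<subseteq> \<Union>\<U>"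
  shows "\<exists>\<V>\<subseteq>\<U>. C \<subseteq> \<Union>\<V> \<and> \<V> \<lesssim> K"
proof -
  let ?\<U> = "insert (topspace X - C) \<U>"
  have "(\<forall>U\<in>?\<U>. openin X U) \<and> topspace X \<subseteq> \<Union>?\<U>"
    using \<U> C by auto
  then obtain \<V> where \<V>: "\<V> \<subseteq> ?\<U>" "topspace X \<subseteq> \<Union>\<V>" "\<V> \<lesssim> K"
    using K unfolding lindelof_le_def by meson
  have "C \<subseteq> \<Union>(\<V> \<inter> \<U>)"
    using \<V>(1,2) closedin_subset[OF C] by blast
  moreover have "\<V> \<inter> \<U> \<lesssim> K"
    using \<V>(3) by (meson inf_le1 lepoll_trans subset_imp_lepoll)
  ultimately show ?thesis by blast
qed

text \<open>The members of a sieve need not inherit the bound on the Lindelof number, but their closures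
  do. A node of the thinned sieve is therefore an open set whose closure lies in a member of the
  old one.\<close>

definition shrinkings :: "'a topology \<Rightarrow> 'i set \<Rightarrow> ('i \<Rightarrow> 'a set) \<Rightarrow> ('a set \<times> 'i) set" where
  "shrinkings X B U = {(H, \<beta>). \<beta> \<in> B \<and> openin X H \<and> X closure_of H \<subseteq> U \<beta>}"

lemma lindelof_le_shrink_open_cover:
  assumes X: "regular_space X" "lindelof_le X K" and G: "openin X G"
    and U: "\<And>\<beta>. \<beta> \<in> B \<Longrightarrow> openin X (U \<beta>)" "X closure_of G \<subseteq> (\<Union>\<beta>\<in>B. U \<beta>)"
  shows "\<exists>R\<subseteq>shrinkings X B U. R \<lesssim> K \<and> G = (\<Union>w\<in>R. fst w)"
proof -
  define \<U> where "\<U> = fst ` shrinkings X B U"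
  have in_\<U>: "H \<in> \<U> \<longleftrightarrow> openin X H \<and> (\<exists>\<beta>\<in>B. X closure_of H \<subseteq> U \<beta>)" for H
    by (force simp: \<U>_def shrinkings_def image_iff)
  have "\<exists>H\<in>\<U>. x \<in> H" if x: "x \<in> X closure_of G" for x
  proof -
    obtain \<beta> where \<beta>: "\<beta> \<in> B" "x \<in> U \<beta>" using U(2) x by blast
    then obtain H H' where "openin X H" "x \<in> H" "H \<subseteq> H'" "closedin X H'" "H' \<subseteq> U \<beta>"
      using X(1) U(1) unfolding neighbourhood_base_of_closedin[symmetric] neighbourhood_base_of
      by metis
    then have "X closure_of H \<subseteq> U \<beta>"
      using closure_of_minimal by (metis order_trans)
    then show ?thesis
      using \<open>openin X H\<close> \<open>x \<in> H\<close> \<beta>(1) in_\<U> by blast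
  qed
  then have "X closure_of G \<subseteq> \<Union>\<U>" by blast
  then obtain \<V> where \<V>: "\<V> \<subseteq> \<U>" "X closure_of G \<subseteq> \<Union>\<V>" "\<V> \<lesssim> K"
    using lindelof_le_closedin[OF X(2) closedin_closure_of, of \<U> G] in_\<U> by meson
  have "\<forall>H\<in>\<V>. \<exists>\<beta>\<in>B. openin X H \<and> X closure_of H \<subseteq> U \<beta>"
    using \<V>(1) in_\<U> by blast
  then obtain b where b: "\<And>H. H \<in> \<V> \<Longrightarrow> b H \<in> B \<and> openin X H \<and> X closure_of H \<subseteq> U (b H)"
    by metis
  define R where "R = (\<lambda>H. (H \<inter> G, b H)) ` \<V>"
  have "R \<lesssim> K"
    unfolding R_def using image_lepoll \<V>(3) by (rule lepoll_trans)
  moreover have "G \<subseteq> X closure_of G"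
    using G by (intro closure_of_subset openin_subset)
  then have "G = (\<Union>w\<in>R. fst w)"
    using \<V>(2) by (auto simp: R_def)
  moreover have "X closure_of (H \<inter> G) \<subseteq> X closure_of H" for H
    by (intro closure_of_mono) auto
  then have "R \<subseteq> shrinkings X B U"
    using b G by (fastforce simp: R_def shrinkings_def)
  ultimately show ?thesis by blast
qed

definition shrinking_children :: "'a topology \<Rightarrow> (nat \<Rightarrow> 'i set) \<Rightarrow> (nat \<Rightarrow> 'i \<Rightarrow> 'a set)
    \<Rightarrow> (nat \<Rightarrow> 'i \<Rightarrow> 'i) \<Rightarrow> nat \<Rightarrow> 'a set \<times> 'i \<Rightarrow> ('a set \<times> 'i) set" where
  "shrinking_children X I U p n v =
     {w \<in> shrinkings X (I (Suc n)) (U (Suc n)). p n (snd w) = snd v}"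

lemma lindelof_le_shrinking_children:
  assumes X: "regular_space X" "lindelof_le X K" and sieve: "is_sieve X I U p"
    and v: "v \<in> shrinkings X (I n) (U n)"
  shows "\<exists>R\<subseteq>shrinking_children X I U p n v. R \<lesssim> K \<and> fst v = (\<Union>w\<in>R. fst w)"
proof -
  let ?B = "{\<beta> \<in> I (Suc n). p n \<beta> = snd v}"
  have v_shrinks: "snd v \<in> I n" "openin X (fst v)" "X closure_of fst v \<subseteq> U n (snd v)"
    using v by (auto simp: shrinkings_def)
  then have "X closure_of fst v \<subseteq> (\<Union>\<beta>\<in>?B. U (Suc n) \<beta>)"
    using is_sieve_children[OF sieve] by simp
  then have "\<exists>R\<subseteq>shrinkings X ?B (U (Suc n)). R \<lesssim> K \<and> fst v = (\<Union>w\<in>R. fst w)"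
    using is_sieve_openin[OF sieve] by (intro lindelof_le_shrink_open_cover[OF X v_shrinks(2)]) auto
  moreover have "shrinkings X ?B (U (Suc n)) \<subseteq> shrinking_children X I U p n v"
    by (auto simp: shrinking_children_def shrinkings_def)
  ultimately show ?thesis by (meson subset_trans)
qed

lemma complete_sieve_histories_shrinkings:
  assumes S: "complete_sieve X I U p"
    and A: "A \<subseteq> shrinkings X (I 0) (U 0)" "topspace X = (\<Union>v\<in>A. fst v)"
    and ch: "\<And>n v. v \<in> shrinkings X (I n) (U n) \<Longrightarrow> ch n v \<subseteq> shrinking_children X I U p n v"
      "\<And>n v. v \<in> shrinkings X (I n) (U n) \<Longrightarrow> fst v = (\<Union>w\<in>ch n v. fst w)"
  shows "complete_sieve X (histories A ch) (\<lambda>n xs. fst (hd xs)) (\<lambda>_. tl)"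
proof (rule complete_sieve_histories[where N = "\<lambda>n. shrinkings X (I n) (U n)" and V = "\<lambda>_. fst",
      OF A _ ch(2)])
  show "openin X (fst v)" if "v \<in> shrinkings X (I n) (U n)" for n v
    using that by (auto simp: shrinkings_def)
  show "ch n v \<subseteq> shrinkings X (I (Suc n)) (U (Suc n))" if "v \<in> shrinkings X (I n) (U n)" for n v
    using ch(1)[OF that] by (auto simp: shrinking_children_def)
  fix v assume v: "\<And>n. v n \<in> shrinkings X (I n) (U n)" "\<And>n. v (Suc n) \<in> ch n (v n)"
  have v_shrinks: "snd (v n) \<in> I n" "openin X (fst (v n))"
    "X closure_of fst (v n) \<subseteq> U n (snd (v n))" for n
    using v(1)[of n] by (auto simp: shrinkings_def)
  have "p n (snd (v (Suc n))) = snd (v n)" for n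
    using ch(1)[OF v(1)] v(2) by (auto simp: shrinking_children_def)
  then have "pi_chain I p (\<lambda>n. snd (v n))"
    using v_shrinks(1) by (simp add: pi_chain_def)
  then have "complete_family X (range (\<lambda>n. U n (snd (v n))))"
    using S by (simp add: complete_sieve_iff_complete_family)
  moreover have "fst (v n) \<subseteq> U n (snd (v n))" for n
    using v_shrinks(2,3)[of n] closure_of_subset[OF openin_subset] by (meson subset_trans)
  then have "\<forall>W\<in>range (\<lambda>n. U n (snd (v n))). \<exists>V\<in>range (\<lambda>n. fst (v n)). V \<subseteq> W"
    by auto
  ultimately show "complete_family X (range (\<lambda>n. fst (v n)))"
    by (rule complete_family_refine)
qed

lemma lindelof_le_thin_sieve:
  fixes X :: "'a topology" and I :: "nat \<Rightarrow> 'i set"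
  assumes X: "regular_space X" "lindelof_le X K" and K: "infinite K" and S: "complete_sieve X I U p"
  shows "\<exists>(J :: nat \<Rightarrow> ('a set \<times> 'i) list set) V q. complete_sieve X J V q \<and> (\<forall>n. J n \<lesssim> K)"
proof -
  have sieve: "is_sieve X I U p"
    using S by (rule complete_sieve_imp_is_sieve)
  let ?N = "\<lambda>n. shrinkings X (I n) (U n)" and ?C = "shrinking_children X I U p"
  have "X closure_of topspace X \<subseteq> (\<Union>\<alpha>\<in>I 0. U 0 \<alpha>)"
    using is_sieve_cover[OF sieve] by simp
  then have "\<exists>A\<subseteq>?N 0. A \<lesssim> K \<and> topspace X = (\<Union>v\<in>A. fst v)"
    by (intro lindelof_le_shrink_open_cover[OF X openin_topspace] is_sieve_openin[OF sieve])
  then obtain A where A: "A \<subseteq> ?N 0" "A \<lesssim> K" "topspace X = (\<Union>v\<in>A. fst v)"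
    by blast
  have "\<forall>n. \<forall>v\<in>?N n. \<exists>R. R \<subseteq> ?C n v \<and> R \<lesssim> K \<and> fst v = (\<Union>w\<in>R. fst w)"
    using lindelof_le_shrinking_children[OF X sieve] by blast
  then obtain ch where
    "\<forall>n. \<forall>v\<in>?N n. ch n v \<subseteq> ?C n v \<and> ch n v \<lesssim> K \<and> fst v = (\<Union>w\<in>ch n v. fst w)"
    by (auto simp only: bchoice_iff choice_iff)
  then have ch_C: "ch n v \<subseteq> ?C n v" and ch_lepoll: "ch n v \<lesssim> K"
    and ch_UN: "fst v = (\<Union>w\<in>ch n v. fst w)" if "v \<in> ?N n" for n v
    using that by blast+
  have "complete_sieve X (histories A ch) (\<lambda>n xs. fst (hd xs)) (\<lambda>_. tl)"
    using S A(1,3) ch_C ch_UN by (rule complete_sieve_histories_shrinkings)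
  moreover have "ch n v \<subseteq> ?N (Suc n)" if "v \<in> ?N n" for n v
    using ch_C[OF that] by (auto simp: shrinking_children_def)
  then have "histories A ch n \<lesssim> K" for n
    using K A(1,2) ch_lepoll by (intro histories_lepoll[where N = ?N])
  ultimately show ?thesis by blast
qed

lemma complete_sieve_member_finitely_covered:
  assumes "regular_space X" and S: "complete_sieve X I U p"
    and \<V>: "\<And>V. V \<in> \<V> \<Longrightarrow> openin X V" "topspace X \<subseteq> \<Union>\<V>" and x: "x \<in> topspace X"
  shows "\<exists>n. \<exists>\<alpha>\<in>I n. x \<in> U n \<alpha> \<and> (\<exists>\<F>\<in>Fpow \<V>. U n \<alpha> \<subseteq> \<Union>\<F>)"
proof -
  have sieve: "is_sieve X I U p"
    using S by (rule complete_sieve_imp_is_sieve)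
  obtain c where c: "pi_chain I p c" "\<And>n. x \<in> U n (c n)"
    using is_sieve_pi_chain_through[OF sieve x] by blast
  have c_I: "c n \<in> I n" for n
    using c(1) by (simp add: pi_chain_def)
  let ?W = "\<lambda>n. U n (c n)"
  have complete: "complete_family X (range ?W)"
    using S c(1) by (simp add: complete_sieve_iff_complete_family)
  then have "compactin X (adherence X (range ?W))"
    using assms(1) by (simp add: compactin_adherence)
  moreover from this have "adherence X (range ?W) \<subseteq> \<Union>\<V>"
    using compactin_subset_topspace \<V>(2) by blast
  ultimately obtain \<F> where \<F>: "finite \<F>" "\<F> \<subseteq> \<V>" "adherence X (range ?W) \<subseteq> \<Union>\<F>"
    using \<V>(1) unfolding compactin_def by meson
  then have "openin X (\<Union>\<F>)"
    using \<V>(1) by blast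
  then obtain n where "U n (c n) \<subseteq> \<Union>\<F>"
    using complete_decseq_eventually_subset[OF complete pi_chain_decseq[OF sieve c(1)]
        openin_subset[OF is_sieve_openin[OF sieve c_I]] _ \<F>(3)] by blast
  moreover have "\<F> \<in> Fpow \<V>"
    using \<F>(1,2) by (simp add: Fpow_def)
  ultimately show ?thesis
    using c_I c(2) by blast
qed

lemma lindelof_le_complete_sieve:
  assumes "regular_space X" and K: "infinite K" "\<And>n. I n \<lesssim> K" and S: "complete_sieve X I U p"
  shows "lindelof_le X K"
  unfolding lindelof_le_def
proof (intro allI impI)
  fix \<V> assume \<V>: "(\<forall>V\<in>\<V>. openin X V) \<and> topspace X \<subseteq> \<Union>\<V>"
  define good where "good n = {\<alpha> \<in> I n. \<exists>\<F>\<in>Fpow \<V>. U n \<alpha> \<subseteq> \<Union>\<F>}" for n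
  then have "\<forall>n. \<forall>\<alpha>\<in>good n. \<exists>\<F>\<in>Fpow \<V>. U n \<alpha> \<subseteq> \<Union>\<F>"
    by blast
  then obtain f where f: "\<And>n \<alpha>. \<alpha> \<in> good n \<Longrightarrow> f n \<alpha> \<in> Fpow \<V> \<and> U n \<alpha> \<subseteq> \<Union>(f n \<alpha>)"
    by metis
  define \<V>' where "\<V>' = (\<Union>n. \<Union>\<alpha>\<in>good n. f n \<alpha>)"
  have "\<V>' \<subseteq> \<V>"
    using f by (fastforce simp: \<V>'_def Fpow_def)
  moreover have "\<V>' \<lesssim> K"
    unfolding \<V>'_def
  proof (intro lepoll_UN_infinite K(1))
    show "(UNIV :: nat set) \<lesssim> K"
      using K(1) by (simp add: infinite_le_lepoll)
    show "good n \<lesssim> K" for n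
      by (rule lepoll_trans[OF subset_imp_lepoll K(2)]) (auto simp: good_def)
    show "f n \<alpha> \<lesssim> K" if "\<alpha> \<in> good n" for n \<alpha>
      using f[OF that] K(1) by (simp add: Fpow_def finite_lepoll_infinite)
  qed
  moreover have "x \<in> \<Union>\<V>'" if x: "x \<in> topspace X" for x
  proof -
    obtain n \<alpha> where \<alpha>: "\<alpha> \<in> I n" "x \<in> U n \<alpha>" "\<exists>\<F>\<in>Fpow \<V>. U n \<alpha> \<subseteq> \<Union>\<F>"
      using complete_sieve_member_finitely_covered[OF assms(1) S, of \<V> x] \<V> x by blast
    then have good: "\<alpha> \<in> good n"
      by (simp add: good_def)
    then have "x \<in> \<Union>(f n \<alpha>)"
      using f \<alpha>(2) by blast
    then show ?thesis
      using good unfolding \<V>'_def by blast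
  qed
  ultimately show "\<exists>\<V>'\<subseteq>\<V>. topspace X \<subseteq> \<Union>\<V>' \<and> \<V>' \<lesssim> K" by blast
qed

section \<open>Tri-quotient images\<close>

locale tri_quotient_selector =
  fixes X :: "'a topology" and Y :: "'b topology"
    and F :: "'a set \<Rightarrow> 'b set" and s :: "'a set \<Rightarrow> 'b set"
  assumes s_openin: "openin X U \<Longrightarrow> openin Y (s U)"
    and s_subset: "openin X U \<Longrightarrow> s U \<subseteq> \<Union>{F K | K. compactin X K \<and> K \<subseteq> U}"
    and s_topspace: "s (topspace X) = topspace Y"
    and s_mono: "\<lbrakk>openin X U; openin X V; U \<subseteq> V\<rbrakk> \<Longrightarrow> s U \<subseteq> s V"
    and s_finite: "\<lbrakk>openin X U; y \<in> s U; \<forall>W\<in>\<W>. openin X W;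
        \<Union>{K. compactin X K \<and> y \<in> F K \<and> K \<subseteq> U} \<subseteq> \<Union>\<W>\<rbrakk>
        \<Longrightarrow> \<exists>\<E>. finite \<E> \<and> \<E> \<subseteq> \<W> \<and> y \<in> s (\<Union>\<E>)"

lemma set_tri_quotient_iff_selector:
  "set_tri_quotient X Y F \<longleftrightarrow> (\<exists>s. tri_quotient_selector X Y F s)"
  unfolding set_tri_quotient_def tri_quotient_selector_def
  by (intro ex_cong1) (simp add: atomize_all atomize_imp imp_conjL)

context tri_quotient_selector
begin

lemma s_finite_subcover:
  assumes "openin X G" "y \<in> s G" "\<And>\<alpha>. \<alpha> \<in> A \<Longrightarrow> openin X (U \<alpha>)" "G \<subseteq> (\<Union>\<alpha>\<in>A. U \<alpha>)"
  shows "\<exists>E\<in>Fpow A. y \<in> s (\<Union>\<alpha>\<in>E. U \<alpha>)"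
proof -
  have "\<exists>\<E>. finite \<E> \<and> \<E> \<subseteq> U ` A \<and> y \<in> s (\<Union>\<E>)"
    using assms by (intro s_finite[of G]) auto
  then show ?thesis
    unfolding Fpow_def by (metis (mono_tags, lifting) finite_subset_image mem_Collect_eq)
qed

lemma s_cover_Fpow:
  assumes "is_sieve X I U p"
  shows "topspace Y = (\<Union>E\<in>Fpow (I 0). s (\<Union>\<alpha>\<in>E. U 0 \<alpha>))"
proof
  show "topspace Y \<subseteq> (\<Union>E\<in>Fpow (I 0). s (\<Union>\<alpha>\<in>E. U 0 \<alpha>))"
    using s_finite_subcover[of "topspace X" _ "I 0" "U 0"] s_topspace
      is_sieve_openin[OF assms] is_sieve_cover[OF assms] by fastforce
  show "(\<Union>E\<in>Fpow (I 0). s (\<Union>\<alpha>\<in>E. U 0 \<alpha>)) \<subseteq> topspace Y"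
    using is_sieve_openin[OF assms]
    by (intro UN_least openin_subset s_openin openin_Union) (auto simp: Fpow_def)
qed

lemma s_UN_refinements:
  assumes S: "is_sieve X I U p" and E: "E \<in> Fpow (I n)"
  shows "s (\<Union>\<alpha>\<in>E. U n \<alpha>) = (\<Union>E'\<in>refinements I p n E. s (\<Union>\<beta>\<in>E'. U (Suc n) \<beta>))"
proof
  have E_I: "E \<subseteq> I n"
    using E by (simp add: Fpow_def)
  have openE: "openin X (\<Union>\<alpha>\<in>E. U n \<alpha>)"
    using is_sieve_openin[OF S] E_I by blast
  show "s (\<Union>\<alpha>\<in>E. U n \<alpha>) \<subseteq> (\<Union>E'\<in>refinements I p n E. s (\<Union>\<beta>\<in>E'. U (Suc n) \<beta>))"
  proof
    fix y assume y: "y \<in> s (\<Union>\<alpha>\<in>E. U n \<alpha>)"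
    have "U n \<alpha> \<subseteq> (\<Union>\<beta>\<in>{\<beta> \<in> I (Suc n). p n \<beta> \<in> E}. U (Suc n) \<beta>)" if "\<alpha> \<in> E" for \<alpha>
      using is_sieve_children[OF S, of \<alpha> n] E_I that by blast
    then have "\<exists>E'\<in>Fpow {\<beta> \<in> I (Suc n). p n \<beta> \<in> E}. y \<in> s (\<Union>\<beta>\<in>E'. U (Suc n) \<beta>)"
      using is_sieve_openin[OF S] by (intro s_finite_subcover[OF openE y] UN_least) auto
    then show "y \<in> (\<Union>E'\<in>refinements I p n E. s (\<Union>\<beta>\<in>E'. U (Suc n) \<beta>))"
      by (auto simp: refinements_def Fpow_def subset_iff image_subset_iff)
  qed
  show "(\<Union>E'\<in>refinements I p n E. s (\<Union>\<beta>\<in>E'. U (Suc n) \<beta>)) \<subseteq> s (\<Union>\<alpha>\<in>E. U n \<alpha>)"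
  proof (rule UN_least)
    fix E' assume E': "E' \<in> refinements I p n E"
    then have "openin X (\<Union>\<beta>\<in>E'. U (Suc n) \<beta>)"
      using is_sieve_openin[OF S] by (auto simp: refinements_def Fpow_def)
    then show "s (\<Union>\<beta>\<in>E'. U (Suc n) \<beta>) \<subseteq> s (\<Union>\<alpha>\<in>E. U n \<alpha>)"
      using openE refinements_UN_subset[OF S E'] by (rule s_mono)
  qed
qed

end

locale mu_tri_quotient_selector = tri_quotient_selector +
  assumes regular: "regular_space X" and mu: "mu_space Y"
    and F_compact: "maps_compacts X Y F" and F_mono: "monotone_on_compacts X F"
begin

lemma selections_in_compact_image:
  assumes W: "complete_family X (range W)" "decseq W" "\<And>n. openin X (W n)"
  shows "selections_in_compact Y (\<lambda>n. s (W n))"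
  unfolding selections_in_compact_def
proof (intro allI impI)
  fix y assume y: "\<forall>n. y n \<in> s (W n)"
  have "\<exists>K. compactin X K \<and> K \<subseteq> W n \<and> y n \<in> F K" for n
    using s_subset[OF W(3)[of n]] y by blast
  then obtain K where K: "\<And>n. compactin X (K n)" "\<And>n. K n \<subseteq> W n" "\<And>n. y n \<in> F (K n)"
    by metis
  define L where "L = adherence X (range W) \<union> (\<Union>n. K n)"
  have L: "compactin X L"
    unfolding L_def using regular W(1,2) openin_subset[OF W(3)] K(1,2)
    by (rule complete_decseq_compactin_Un)
  have "F (K n) \<subseteq> F L" for n
    using F_mono K(1) L unfolding monotone_on_compacts_def L_def by blast
  then show "\<exists>C. compactin Y C \<and> range y \<subseteq> C"
    using L F_compact K(3) unfolding maps_compacts_def by blast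
qed

lemma complete_family_image:
  assumes W: "complete_family X (range W)" "decseq W" "\<And>n. openin X (W n)"
  shows "complete_family Y (range (\<lambda>n. s (W n)))"
proof (rule mu_space_complete_decseq[OF mu selections_in_compact_image[OF W]])
  show "decseq (\<lambda>n. s (W n))"
    using W(2,3) s_mono by (simp add: decseq_Suc_iff)
qed

lemma complete_sieve_image:
  assumes S: "complete_sieve X I U p"
  shows "complete_sieve Y (histories (Fpow (I 0)) (refinements I p))
    (\<lambda>n Es. s (\<Union>\<alpha>\<in>hd Es. U n \<alpha>)) (\<lambda>_. tl)"
proof (rule complete_sieve_histories[where N = "\<lambda>n. Fpow (I n)" and V = "\<lambda>n E. s (\<Union>\<alpha>\<in>E. U n \<alpha>)"])
  have sieve: "is_sieve X I U p"
    using S by (rule complete_sieve_imp_is_sieve)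
  show "topspace Y = (\<Union>E\<in>Fpow (I 0). s (\<Union>\<alpha>\<in>E. U 0 \<alpha>))"
    using sieve by (rule s_cover_Fpow)
  have open_UN: "openin X (\<Union>\<alpha>\<in>E. U n \<alpha>)" if "E \<in> Fpow (I n)" for n E
    using is_sieve_openin[OF sieve] that by (auto simp: Fpow_def)
  then show "openin Y (s (\<Union>\<alpha>\<in>E. U n \<alpha>))" if "E \<in> Fpow (I n)" for n E
    using that by (intro s_openin)
  show "s (\<Union>\<alpha>\<in>E. U n \<alpha>) = (\<Union>E'\<in>refinements I p n E. s (\<Union>\<beta>\<in>E'. U (Suc n) \<beta>))"
    if "E \<in> Fpow (I n)" for n E
    using sieve that by (rule s_UN_refinements)
  show "refinements I p n E \<subseteq> Fpow (I (Suc n))" for n E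
    by (auto simp: refinements_def)
  fix E assume E: "\<And>n. E n \<in> Fpow (I n)" "\<And>n. E (Suc n) \<in> refinements I p n (E n)"
  show "complete_family Y (range (\<lambda>n. s (\<Union>\<alpha>\<in>E n. U n \<alpha>)))"
  proof (rule complete_family_image[OF _ _ open_UN[OF E(1)]])
    show "complete_family X (range (\<lambda>n. \<Union>\<alpha>\<in>E n. U n \<alpha>))"
      using S E by (rule complete_sieve_finite_unions)
    show "decseq (\<lambda>n. \<Union>\<alpha>\<in>E n. U n \<alpha>)"
      by (intro decseq_SucI refinements_UN_subset[OF sieve E(2)])
  qed
qed simp

end

text \<open>Trailing empty sets leave no trace, so the encoding is injective only on lists of a fixed
  length.\<close>

definition encode_history :: "'i set list \<Rightarrow> ('i list \<times> 'a set \<times> 'b set) set" where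
  "encode_history Es = {(replicate (Suc k) \<alpha>, {}, {}) | k \<alpha>. k < length Es \<and> \<alpha> \<in> Es ! k}"

lemma in_encode_history:
  "(replicate (Suc k) \<alpha>, {}, {}) \<in> encode_history Es \<longleftrightarrow> k < length Es \<and> \<alpha> \<in> Es ! k"
proof -
  have "replicate (Suc k) \<alpha> = replicate (Suc j) \<beta> \<longleftrightarrow> k = j \<and> \<alpha> = \<beta>" for j \<beta>
    by (auto dest: arg_cong[of _ _ length])
  then show ?thesis
    unfolding encode_history_def by (auto simp del: replicate_Suc)
qed

lemma inj_on_encode_history: "inj_on encode_history {Es. length Es = n}"
proof (rule inj_onI, elim CollectE)
  fix Ds Es :: "'i set list"
  assume len: "length Ds = n" "length Es = n" and eq: "encode_history Ds = encode_history Es"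
  have "\<alpha> \<in> Ds ! k \<longleftrightarrow> \<alpha> \<in> Es ! k" if "k < n" for k \<alpha>
    using in_encode_history eq len that by metis
  then show "Ds = Es"
    using len by (intro nth_equalityI set_eqI) auto
qed

theorem theorem1p4:
  fixes X :: "'a topology" and Y :: "'b topology" and F :: "'a set \<Rightarrow> 'b set"
  assumes "tychonoff X" and "tychonoff Y"
    and "sieve_complete_with X TYPE('i)"
    and "mu_space Y"
    and "maps_compacts X Y F"
    and "monotone_on_compacts X F"
    and "set_tri_quotient X Y F"
  shows "sieve_complete_with Y TYPE(('i list \<times> 'a set \<times> 'b set) set) \<and>
    (\<forall>K :: 'c set. infinite K \<and> lindelof_le X K \<longrightarrow> lindelof_le Y K)"
proof (intro conjI allI impI)
  have regular_X: "regular_space X" and regular_Y: "regular_space Y"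
    using assms(1,2) by (simp_all add: tychonoff_def completely_regular_imp_regular_space)
  obtain s where "tri_quotient_selector X Y F s"
    using assms(7) by (auto simp: set_tri_quotient_iff_selector)
  then interpret mu_tri_quotient_selector X Y F s
    using regular_X assms(4-6)
    by (simp add: mu_tri_quotient_selector_def mu_tri_quotient_selector_axioms_def)
  obtain I U p where S: "complete_sieve X (I :: nat \<Rightarrow> 'i set) U p"
    using assms(3) unfolding sieve_complete_with_def by blast
  have "inj_on encode_history (histories (Fpow (I 0)) (refinements I p) n)" for n
    by (rule inj_on_subset[OF inj_on_encode_history[of "Suc n"]]) (auto simp: length_histories)
  then show "sieve_complete_with Y TYPE(('i list \<times> 'a set \<times> 'b set) set)"
    using complete_sieve_inj_reindex[OF complete_sieve_image[OF S]]
    unfolding sieve_complete_with_def by blast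
  fix K :: "'c set" assume K: "infinite K \<and> lindelof_le X K"
  then obtain J V q
    where J: "complete_sieve X (J :: nat \<Rightarrow> ('a set \<times> 'i) list set) V q" "\<And>n. J n \<lesssim> K"
    using lindelof_le_thin_sieve[OF regular_X _ _ S] by blast
  then have "histories (Fpow (J 0)) (refinements J q) n \<lesssim> K" for n
    using K by (intro histories_refinements_lepoll) auto
  then show "lindelof_le Y K"
    using lindelof_le_complete_sieve[OF regular_Y] K complete_sieve_image[OF J(1)] by blast
qed

end
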